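(* Let $h>0$, let $K\ge1$ be an integer, and suppose that: (i) the control set $U\subset\mathbb{R}^q$ is nonempty and compact; (ii) $F_h(x,u)=A_hx+B_hu+b_h$ for $x\in\mathbb{R}^n$, $u\in U$ (affine one-step dynamics); (iii) the terminal reward $\phi:\mathbb{R}^n\to\mathbb{R}$ is continuous and $c_K$-semiconvex, for some $c_K\ge 0$; (iv) there exists $\gamma_h\ge0$ such that, for every $u\in U$, the map $x\mapsto h\,\ell(x,u)$ is continuous and $\gamma_h$-semiconvex on $\mathbb{R}^n$. Let $v_k^h$ be the discrete-time value functions, and let $(\widehat v_k^{h,m})_{0\le k\le K,\,m\ge0}$, with numbers of basis functions $r_k^{(m)}$, be any sequence generated by the trajectory-based iterative algorithm described in the context, started from initial functions satisfying $\widehat v_k^{h,0}\le v_k^h$ for $k=0,\dots,K$. Then, for every $m\ge1$ and every $k=0,\dots,K$, $$\widehat v_k^{h,m-1}\le\widehat v_k^{h,m}\le v_k^h .$$ In particular, $(\widehat v_k^{h,m})_{m\ge0}$ is monotone nondecreasing and remains a family of lower bounds for $v_k^h$. Moreover, $$r_k^{(m)}\le r_k^{(0)}+m,\qquad k=0,\dots,K .$$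
   Context: Semiconvexity: for $c\ge0$, $g:\mathbb{R}^n\to\mathbb{R}$ is $c$-semiconvex if $g+\frac c2\|\cdot\|^2$ is convex (Euclidean norm). All inequalities between functions are pointwise on $\mathbb{R}^n$. Value functions: $\ell:\mathbb{R}^n\times U\to\mathbb{R}$ is the running reward. For $\psi:\mathbb{R}^n\to\mathbb{R}$ set $(T_h\psi)(x)=\sup_{u\in U}\{h\,\ell(x,u)+\psi(F_h(x,u))\}$. The value functions are $v_K^h=\phi$ and $v_k^h=T_h[v_{k+1}^h]$ for $k=K-1,\dots,0$, assumed finite-valued. Set $c_k:=\gamma_h+\|A_h\|^2c_{k+1}$ for $k=K-1,\dots,0$, where $\|A_h\|$ is the Euclidean operator norm. Algorithm. At each outer iteration $m\ge0$ and time $k$, the approximation is a finite maximum $$\widehat v_k^{h,m}(x)=\max_{1\le j\le r_k^{(m)}}w_{k,j}^{h,m}(x),\qquad w_{k,j}^{h,m}(x)=\beta+p\cdot(x-a)-\tfrac{c_k}{2}\|x-a\|^2,$$ with $\beta\in\mathbb{R}$, $p,a\in\mathbb{R}^n$ depending on $k,j,m$, and $r_k^{(m)}$ is the number of basis functions. Initialization: an initial point $x_0$, a trajectory $x^{(0)}=(x_0^{(0)},\dots,x_K^{(0)})$ in $\mathbb{R}^n$ with $x_0^{(0)}=x_0$ that is admissible (i.e. $x_{k+1}^{(0)}=F_h(x_k^{(0)},u_k)$ for some $u_k\in U$), and functions $\widehat v_k^{h,0}$, each a finite maximum of $r_k^{(0)}$ functions of the form $x\mapsto\beta+p\cdot(x-a)-\frac{c_k}{2}\|x-a\|^2$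 with $\beta\in\mathbb{R}$, $p,a\in\mathbb{R}^n$, with $\widehat v_k^{h,0}\le v_k^h$ for all $k$ and $\widehat v_K^{h,0}=\phi$ (so $\phi$ is assumed to be a finite maximum of functions of the form $x\mapsto\beta+p\cdot(x-a)-\frac{c_K}{2}\|x-a\|^2$). One keeps $\widehat v_K^{h,m}=\phi$ (with the same basis functions) for all $m$. Outer iteration $m\ge1$, backward step, for $k=K-1,\dots,0$: choose $$u_k\in\operatorname{arg\,max}_{u\in U}\{h\,\ell(x_k^{(m-1)},u)+\widehat v_{k+1}^{h,m-1}(F_h(x_k^{(m-1)},u))\};$$ choose an index $j$ of a basis function active at the successor state, i.e. $w_{k+1,j}^{h,m-1}(y)=\widehat v_{k+1}^{h,m-1}(y)$ with $y=F_h(x_k^{(m-1)},u_k)$; let $$G_k^{(m)}(x)=h\,\ell(x,u_k)+w_{k+1,j}^{h,m-1}(F_h(x,u_k));$$ choose $p\in\mathbb{R}^n$ such that $w(x)=G_k^{(m)}(x_k^{(m-1)})+p\cdot(x-x_k^{(m-1)})-\frac{c_k}{2}\|x-x_k^{(m-1)}\|^2$ satisfies $w\le G_k^{(m)}$ on $\mathbb{R}^n$ (equality holds at $x_k^{(m-1)}$). Put $\widehat v_k^{h,m}=\max(\widehat v_k^{h,m-1},w)$: if $w$ is not one of the basis functions of $\widehat v_k^{h,m-1}$, it is added to the list and $r_k^{(m)}=r_k^{(m-1)}+1$; otherwise the list is unchanged and $r_k^{(m)}=r_k^{(m-1)}$. Forward step: $x_0^{(m)}=x_0$ and, for $k=0,\dots,K-1$,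 choose $u_k^{(m)}\in\operatorname{arg\,max}_{u\in U}\{h\,\ell(x_k^{(m)},u)+\widehat v_{k+1}^{h,m}(F_h(x_k^{(m)},u))\}$ and set $x_{k+1}^{(m)}=F_h(x_k^{(m)},u_k^{(m)})$. It is understood that all the maximizers used by the algorithm exist. *)

theory Defs
  imports "HOL-Analysis.Analysis"
begin

definition semiconvex :: "real \<Rightarrow> ('x::real_inner \<Rightarrow> real) \<Rightarrow> bool" where
  "semiconvex c g \<longleftrightarrow> convex_on UNIV (\<lambda>x. g x + c / 2 * (norm x)\<^sup>2)"

text \<open>The supremum is taken in the extended reals, so that it is meaningful without any
  boundedness assumption.\<close>

definition bellman ::
  "real \<Rightarrow> ('x \<Rightarrow> 'u \<Rightarrow> real) \<Rightarrow> ('x \<Rightarrow> 'u \<Rightarrow> 'x) \<Rightarrow> 'u set \<Rightarrow> ('x \<Rightarrow> real) \<Rightarrow> 'x \<Rightarrow> ereal" where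
  "bellman h l F U \<psi> x = (SUP u\<in>U. ereal (h * l x u + \<psi> (F x u)))"

text \<open>That each \<open>v k\<close> is real-valued and equals the extended real supremum expresses that the
  value functions are finite. Only the values \<open>v k\<close> with \<open>k \<le> K\<close> are constrained, and these
  are determined uniquely.\<close>

definition value_functions ::
  "real \<Rightarrow> ('x \<Rightarrow> 'u \<Rightarrow> real) \<Rightarrow> ('x \<Rightarrow> 'u \<Rightarrow> 'x) \<Rightarrow> 'u set \<Rightarrow> nat \<Rightarrow> ('x \<Rightarrow> real)
    \<Rightarrow> (nat \<Rightarrow> 'x \<Rightarrow> real) \<Rightarrow> bool" where
  "value_functions h l F U K \<phi> v \<longleftrightarrow>
     v K = \<phi> \<and> (\<forall>k<K. \<forall>x. ereal (v k x) = bellman h l F U (v (Suc k)) x)"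

definition quad_fun :: "real \<Rightarrow> real \<Rightarrow> 'x::real_inner \<Rightarrow> 'x \<Rightarrow> 'x \<Rightarrow> real" where
  "quad_fun c \<beta> p a x = \<beta> + p \<bullet> (x - a) - c / 2 * (norm (x - a))\<^sup>2"

text \<open>An approximation is stored as the list of its basis functions, whose length is the number
  of basis functions. The elements are functions rather than parameter triples because distinct
  triples can describe the same function. The maximum is meaningful only for nonempty lists.\<close>

definition max_fun :: "('x \<Rightarrow> real) list \<Rightarrow> 'x \<Rightarrow> real" where
  "max_fun ws x = (MAX w\<in>set ws. w x)"

definition greedy_control ::
  "real \<Rightarrow> ('x \<Rightarrow> 'u \<Rightarrow> real) \<Rightarrow> ('x \<Rightarrow> 'u \<Rightarrow> 'x) \<Rightarrow> 'u set \<Rightarrow> ('x \<Rightarrow> real) \<Rightarrow> 'x \<Rightarrow> 'u \<Rightarrow> bool" where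
  "greedy_control h l F U \<psi> y u \<longleftrightarrow>
     is_arg_max (\<lambda>u'. h * l y u' + \<psi> (F y u')) (\<lambda>u'. u' \<in> U) u"

text \<open>One backward update at the point \<open>y\<close>: \<open>Wnext\<close> is the previous iterate's list at time
  \<open>k + 1\<close>, and \<open>W\<close>, \<open>W'\<close> are the lists at time \<open>k\<close> before and after the update.\<close>

definition backward_step ::
  "real \<Rightarrow> ('x::real_inner \<Rightarrow> 'u \<Rightarrow> real) \<Rightarrow> ('x \<Rightarrow> 'u \<Rightarrow> 'x) \<Rightarrow> 'u set \<Rightarrow> real \<Rightarrow> 'x
    \<Rightarrow> ('x \<Rightarrow> real) list \<Rightarrow> ('x \<Rightarrow> real) list \<Rightarrow> ('x \<Rightarrow> real) list \<Rightarrow> bool" where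
  "backward_step h l F U c y Wnext W W' \<longleftrightarrow>
     (\<exists>u j p. greedy_control h l F U (max_fun Wnext) y u \<and>
        j < length Wnext \<and> (Wnext ! j) (F y u) = max_fun Wnext (F y u) \<and>
        (let G = (\<lambda>x. h * l x u + (Wnext ! j) (F x u));
             w = quad_fun c (G y) p y
         in (\<forall>x. w x \<le> G x) \<and> W' = (if w \<in> set W then W else W @ [w])))"

text \<open>\<open>W m k\<close> is the list of basis functions and \<open>X m k\<close> the trajectory point at outer iteration
  \<open>m\<close> and time \<open>k\<close>. The predicate holds for every outcome of the choices made in the algorithm.\<close>

definition algorithm_run ::
  "real \<Rightarrow> ('x::real_inner \<Rightarrow> 'u \<Rightarrow> real) \<Rightarrow> ('x \<Rightarrow> 'u \<Rightarrow> 'x) \<Rightarrow> 'u set \<Rightarrow> nat \<Rightarrow> ('x \<Rightarrow> real)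
    \<Rightarrow> (nat \<Rightarrow> real) \<Rightarrow> 'x \<Rightarrow> (nat \<Rightarrow> nat \<Rightarrow> ('x \<Rightarrow> real) list) \<Rightarrow> (nat \<Rightarrow> nat \<Rightarrow> 'x) \<Rightarrow> bool" where
  "algorithm_run h l F U K \<phi> c x0 W X \<longleftrightarrow>
     X 0 0 = x0 \<and> (\<forall>k<K. \<exists>u\<in>U. X 0 (Suc k) = F (X 0 k) u) \<and>
     (\<forall>k\<le>K. W 0 k \<noteq> [] \<and> (\<forall>w\<in>set (W 0 k). \<exists>\<beta> p a. w = quad_fun (c k) \<beta> p a)) \<and>
     max_fun (W 0 K) = \<phi> \<and>
     (\<forall>m\<ge>1.
        W m K = W (m - 1) K \<and>
        (\<forall>k<K. backward_step h l F U (c k) (X (m - 1) k)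
                  (W (m - 1) (Suc k)) (W (m - 1) k) (W m k)) \<and>
        X m 0 = x0 \<and>
        (\<forall>k<K. \<exists>u. greedy_control h l F U (max_fun (W m (Suc k))) (X m k) u \<and>
                  X m (Suc k) = F (X m k) u))"

end

(* For a fixed control u, the function G that a new basis function minorizes is itself a minorant
   of the Bellman operator applied to the previous approximation at time k + 1. As this operator is
   monotone, being a lower bound of the value functions passes from one iteration to the next. *)

theory Submission
  imports Defs
begin

lemma max_fun_le_iff:
  assumes "ws \<noteq> []"
  shows "max_fun ws x \<le> r \<longleftrightarrow> (\<forall>w\<in>set ws. w x \<le> r)"
  using assms unfolding max_fun_def by (subst Max_le_iff) auto

lemma max_fun_upper:
  assumes "w \<in> set ws"
  shows "w x \<le> max_fun ws x"
  using assms unfolding max_fun_def by (intro Max_ge) auto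

lemma max_fun_mono:
  assumes "ws \<noteq> []" and "set ws \<subseteq> set ws'"
  shows "max_fun ws x \<le> max_fun ws' x"
  using assms max_fun_le_iff max_fun_upper by (metis subsetD)

lemma bellman_mono:
  assumes "\<And>x. \<psi> x \<le> \<psi>' x"
  shows "bellman h l F U \<psi> x \<le> bellman h l F U \<psi>' x"
  unfolding bellman_def by (rule SUP_mono') (simp add: assms)

lemma bellman_upper:
  assumes "u \<in> U"
  shows "ereal (h * l x u + \<psi> (F x u)) \<le> bellman h l F U \<psi> x"
  unfolding bellman_def by (rule SUP_upper2[OF assms]) simp

text \<open>With \<open>u\<close> fixed, replacing the single basis function
  \<open>Wnext ! j\<close> by the larger \<open>max_fun Wnext\<close> turns the bound
  \<open>G\<close> into one term of the supremum over \<open>U\<close>. The rule exposes an update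
  only through the resulting global bound and the way the list grows.\<close>

lemma backward_stepE:
  assumes "backward_step h l F U c y Wnext W W'"
  obtains w where "\<And>x. ereal (w x) \<le> bellman h l F U (max_fun Wnext) x"
    and "W' = (if w \<in> set W then W else W @ [w])"
proof -
  obtain u j w where u: "u \<in> U" and j: "j < length Wnext"
    and w: "\<And>x. w x \<le> h * l x u + (Wnext ! j) (F x u)"
    and W': "W' = (if w \<in> set W then W else W @ [w])"
    using assms unfolding backward_step_def greedy_control_def is_arg_max_def Let_def by blast
  have "ereal (w x) \<le> bellman h l F U (max_fun Wnext) x" for x
  proof -
    have "(Wnext ! j) (F x u) \<le> max_fun Wnext (F x u)"
      using j by (intro max_fun_upper) simp
    then have "ereal (w x) \<le> ereal (h * l x u + max_fun Wnext (F x u))"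
      using w[of x] by simp
    also have "\<dots> \<le> bellman h l F U (max_fun Wnext) x"
      by (rule bellman_upper[OF u])
    finally show ?thesis .
  qed
  then show thesis using W' by (rule that)
qed

lemma backward_step_subset:
  assumes "backward_step h l F U c y Wnext W W'"
  shows "set W \<subseteq> set W'"
  using assms by (rule backward_stepE) auto

lemma backward_step_length:
  assumes "backward_step h l F U c y Wnext W W'"
  shows "length W' \<le> Suc (length W)"
  using assms by (rule backward_stepE) auto

text \<open>The new maximum is bounded entry by entry. Old entries lie below \<open>v\<close> by
  assumption; an added one lies below the Bellman operator at \<open>max_fun Wnext\<close>, hence at
  the larger \<open>v'\<close>, where the operator equals \<open>v\<close>.\<close>

lemma backward_step_le:
  assumes "backward_step h l F U c y Wnext W W'" and "W \<noteq> []"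
    and "\<And>x. max_fun W x \<le> v x" and "\<And>x. max_fun Wnext x \<le> v' x"
    and v: "\<And>x. ereal (v x) = bellman h l F U v' x"
  shows "max_fun W' x \<le> v x"
proof -
  obtain w where w: "\<And>x. ereal (w x) \<le> bellman h l F U (max_fun Wnext) x"
    and W': "W' = (if w \<in> set W then W else W @ [w])"
    using backward_stepE[OF assms(1)] by blast
  \<comment> \<open>Since \<open>v x\<close> is real, the extended-real supremum is finite and the
    bound on \<open>w\<close> descends to the reals.\<close>
  have "ereal (w x) \<le> ereal (v x)"
    unfolding v using w bellman_mono[OF assms(4)] by (rule order_trans)
  then show ?thesis
    using assms(2) assms(3)[of x] W' by (auto simp: max_fun_le_iff)
qed

theorem mainTheorem3:
  fixes h \<gamma> :: real and K :: nat
    and U :: "(real ^ 'q) set"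
    and A :: "real ^ 'n ^ 'n" and B :: "real ^ 'q ^ 'n" and b :: "real ^ 'n"
    and F :: "real ^ 'n \<Rightarrow> real ^ 'q \<Rightarrow> real ^ 'n"
    and l :: "real ^ 'n \<Rightarrow> real ^ 'q \<Rightarrow> real"
    and \<phi> :: "real ^ 'n \<Rightarrow> real"
    and c :: "nat \<Rightarrow> real"
    and v :: "nat \<Rightarrow> real ^ 'n \<Rightarrow> real"
    and x0 :: "real ^ 'n"
    and W :: "nat \<Rightarrow> nat \<Rightarrow> (real ^ 'n \<Rightarrow> real) list"
    and X :: "nat \<Rightarrow> nat \<Rightarrow> real ^ 'n"
  assumes "h > 0" and "K \<ge> 1"
    and "U \<noteq> {}" and "compact U"
    and "\<And>x u. u \<in> U \<Longrightarrow> F x u = A *v x + B *v u + b"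
    and "c K \<ge> 0" and "continuous_on UNIV \<phi>" and "semiconvex (c K) \<phi>"
    and "\<gamma> \<ge> 0"
    and "\<And>u. u \<in> U \<Longrightarrow> continuous_on UNIV (\<lambda>x. h * l x u)"
    and "\<And>u. u \<in> U \<Longrightarrow> semiconvex \<gamma> (\<lambda>x. h * l x u)"
    and "\<And>k. k < K \<Longrightarrow> c k = \<gamma> + (onorm ((*v) A))\<^sup>2 * c (Suc k)"
    and "value_functions h l F U K \<phi> v"
    and "algorithm_run h l F U K \<phi> c x0 W X"
    and "\<And>k x. k \<le> K \<Longrightarrow> max_fun (W 0 k) x \<le> v k x"
  shows "(\<forall>m\<ge>1. \<forall>k\<le>K. \<forall>x. max_fun (W (m - 1) k) x \<le> max_fun (W m k) x
                           \<and> max_fun (W m k) x \<le> v k x)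
       \<and> (\<forall>k\<le>K. mono (\<lambda>m. max_fun (W m k)) \<and> (\<forall>m x. max_fun (W m k) x \<le> v k x))
       \<and> (\<forall>m. \<forall>k\<le>K. length (W m k) \<le> length (W 0 k) + m)"
proof -
  have init: "W 0 k \<noteq> []" if "k \<le> K" for k
    using assms(14) that unfolding algorithm_run_def by blast
  have terminal: "W (Suc m) K = W m K" for m
    using assms(14) unfolding algorithm_run_def by (metis diff_Suc_1 le_add1 plus_1_eq_Suc)
  have step: "backward_step h l F U (c k) (X m k) (W m (Suc k)) (W m k) (W (Suc m) k)"
    if "k < K" for m k
    using assms(14) that unfolding algorithm_run_def by (metis diff_Suc_1 le_add1 plus_1_eq_Suc)
  have bellman_v: "ereal (v k x) = bellman h l F U (v (Suc k)) x" if "k < K" for k x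
    using assms(13) that unfolding value_functions_def by blast
  have subset: "set (W m k) \<subseteq> set (W (Suc m) k)" if "k \<le> K" for m k
    using that terminal[of m] backward_step_subset[OF step] by (cases "k = K") auto
  \<comment> \<open>\<open>Max\<close> has no specified value on the empty set, so every comparison
    of maxima relies on this.\<close>
  have nonempty: "W m k \<noteq> []" if "k \<le> K" for m k
    using that
  proof (induction m)
    case (Suc m)
    then show ?case using subset[of k m] by auto
  qed (rule init)
  have incr: "max_fun (W m k) x \<le> max_fun (W (Suc m) k) x" if "k \<le> K" for m k x
    using nonempty[OF that] subset[OF that] by (rule max_fun_mono)
  \<comment> \<open>Induction on \<open>m\<close>, not backwards in time: the list of iteration
    \<open>Suc m\<close> at time \<open>k < K\<close> is built from lists of iteration
    \<open>m\<close> at times \<open>k\<close> and \<open>Suc k\<close>. Hence the hypothesis is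
    used at both times and \<open>k\<close> is generalized.\<close>
  have lower: "max_fun (W m k) x \<le> v k x" if "k \<le> K" for m k x
    using that
  proof (induction m arbitrary: k x)
    case 0
    then show ?case by (rule assms(15))
  next
    case (Suc m)
    show ?case
    proof (cases "k = K")
      case True
      then show ?thesis using Suc terminal[of m] by simp
    next
      case False
      with Suc.prems have "k < K" by simp
      then show ?thesis
        by (intro backward_step_le[OF step nonempty Suc.IH Suc.IH bellman_v]) auto
    qed
  qed
  have len: "length (W m k) \<le> length (W 0 k) + m" if "k \<le> K" for m k
  proof (induction m)
    case (Suc m)
    \<comment> \<open>At \<open>k = K\<close> the list never changes; at earlier times an outer
      iteration makes a single update.\<close>
    have "length (W (Suc m) k) \<le> Suc (length (W m k))"
      using that terminal[of m] backward_step_length[OF step] by (cases "k = K") auto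
    with Suc show ?case by simp
  qed simp
  have "max_fun (W (m - 1) k) x \<le> max_fun (W m k) x" if "m \<ge> 1" "k \<le> K" for m k x
    using incr[OF that(2), of "m - 1" x] that(1) by simp
  moreover have "mono (\<lambda>m. max_fun (W m k))" if "k \<le> K" for k
    \<comment> \<open>The order is the pointwise one on functions, and along the naturals
      consecutive iterates suffice.\<close>
    unfolding mono_iff_le_Suc using incr[OF that] by (simp add: le_fun_def)
  ultimately show ?thesis using lower len by blast
qed

end
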